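(* For $n\geq 4$ we have $$\mathcal{R}_{n+1}=\mathcal{R}_n\sqcup\mathcal{R}_n^{\rho_n}\sqcup\mathcal{R}_n^{\rho_n\rho_{n-1}}\sqcup\ldots\sqcup\mathcal{R}_n^{\rho_n\rho_{n-1}\ldots\rho_1},$$ where $\sqcup$ denotes disjoint union.
   Context: The virtual pure braid group $VP_k$ is generated by the elements $\lambda_{ij}$, $1\le i\ne j\le k$, and its set of defining relations is $\mathcal{R}_k=\mathcal{LR}_k\cup\mathcal{CR}_k$, where $\mathcal{LR}_k$ is the set of long relations and $\mathcal{CR}_k$ is the set of commutativity relations, as follows. For $1\le i<j<l\le k$ let $\mathcal{R}_k^{ijl}$ be the set of six relations $\lambda_{ij}\lambda_{il}\lambda_{jl}=\lambda_{jl}\lambda_{il}\lambda_{ij}$, $\lambda_{ji}\lambda_{jl}\lambda_{il}=\lambda_{il}\lambda_{jl}\lambda_{ji}$, $\lambda_{il}\lambda_{ij}\lambda_{lj}=\lambda_{lj}\lambda_{ij}\lambda_{il}$, $\lambda_{li}\lambda_{lj}\lambda_{ij}=\lambda_{ij}\lambda_{lj}\lambda_{li}$, $\lambda_{jl}\lambda_{ji}\lambda_{li}=\lambda_{li}\lambda_{ji}\lambda_{jl}$, $\lambda_{lj}\lambda_{li}\lambda_{ji}=\lambda_{ji}\lambda_{li}\lambda_{lj}$. Then $\mathcal{LR}_k=\bigsqcup_{1\le i<j<l\le k}\mathcal{R}_k^{ijl}$. For distinct $i,j,l,m\in\{1,\dots,k\}$ with $i<j$, $l<m$, $j>m$ let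 $\mathcal{R}_k^{i,j,l,m}$ be the set of four relations $\lambda_{ij}^*\lambda_{lm}^*=\lambda_{lm}^*\lambda_{ij}^*$, where $\lambda_{ij}^*\in\{\lambda_{ij},\lambda_{ji}\}$ and $\lambda_{lm}^*\in\{\lambda_{lm},\lambda_{ml}\}$. Then $\mathcal{CR}_k=\bigsqcup\mathcal{R}_k^{i,j,l,m}$ over all such $i,j,l,m$. The symmetric group $S_{n+1}=\langle\rho_1,\dots,\rho_n\rangle$, with $\rho_k$ the transposition $(k,k+1)$, is a subgroup of the virtual braid group $VB_{n+1}=VP_{n+1}\rtimes S_{n+1}$ and acts by conjugation on the generators of $VP_{n+1}$ by $\rho_k\lambda_{ij}\rho_k=\lambda_{\rho_k(i),\rho_k(j)}$, $k=1,\dots,n$. For $g\in S_{n+1}$ write $x^g=g^{-1}xg$, so that $x^{\rho_n\rho_{n-1}}=(x^{\rho_n})^{\rho_{n-1}}$ and so on; $\mathcal{R}_n^g$ is the set of relations obtained from $\mathcal{R}_n$ by replacing each generator $x$ by $x^g$. Relations of $VP_n$ are viewed as relations among the generators of $VP_{n+1}$ via $\lambda_{ij}\mapsto\lambda_{ij}$. The elements $e,\rho_n,\rho_n\rho_{n-1},\dots,\rho_n\rho_{n-1}\cdots\rho_1$ are the coset representatives in $S_{n+1}=S_n e\sqcup S_n\rho_n\sqcup\ldots\sqcup S_n\rho_n\rho_{n-1}\cdots\rho_1$.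
   Formalization: The union is proved as an ordinary union, not a disjoint one: disjointness fails for every n ≥ 4, since λ12λ13λ23 = λ23λ13λ12 lies in both R_n and R_n^{ρ_n} (ρ_n fixes 1, 2, 3). *)

theory Defs
  imports "HOL-Combinatorics.Transposition"
begin

text \<open>Only positive words occur in the defining relations, so a word is a list of generators and a
  relation \<open>u = v\<close> is the formal pair \<open>(u, v)\<close>; the pair \<open>(v, u)\<close> is a different relation. The sets
  below are sets of formal relations, not of identities in the presented group.\<close>

datatype gen = Lam nat nat

type_synonym word = "gen list"
type_synonym relator = "word \<times> word"

definition long_rels_at :: "nat \<Rightarrow> nat \<Rightarrow> nat \<Rightarrow> relator set" where
  "long_rels_at i j l =
    {([Lam i j, Lam i l, Lam j l], [Lam j l, Lam i l, Lam i j]),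
     ([Lam j i, Lam j l, Lam i l], [Lam i l, Lam j l, Lam j i]),
     ([Lam i l, Lam i j, Lam l j], [Lam l j, Lam i j, Lam i l]),
     ([Lam l i, Lam l j, Lam i j], [Lam i j, Lam l j, Lam l i]),
     ([Lam j l, Lam j i, Lam l i], [Lam l i, Lam j i, Lam j l]),
     ([Lam l j, Lam l i, Lam j i], [Lam j i, Lam l i, Lam l j])}"

definition long_rels :: "nat \<Rightarrow> relator set" where
  "long_rels k = \<Union>{long_rels_at i j l | i j l. 1 \<le> i \<and> i < j \<and> j < l \<and> l \<le> k}"

definition comm_rels_at :: "nat \<Rightarrow> nat \<Rightarrow> nat \<Rightarrow> nat \<Rightarrow> relator set" where
  "comm_rels_at i j l m =
    {([x, y], [y, x]) | x y. x \<in> {Lam i j, Lam j i} \<and> y \<in> {Lam l m, Lam m l}}"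

definition comm_rels :: "nat \<Rightarrow> relator set" where
  "comm_rels k = \<Union>{comm_rels_at i j l m | i j l m.
     {i, j, l, m} \<subseteq> {1..k} \<and> distinct [i, j, l, m] \<and> i < j \<and> l < m \<and> j > m}"

definition VP_rels :: "nat \<Rightarrow> relator set" where
  "VP_rels k = long_rels k \<union> comm_rels k"

definition rho :: "nat \<Rightarrow> nat \<Rightarrow> nat" where
  "rho k = transpose k (Suc k)"

text \<open>\<open>conj_gen x g\<close> is \<open>x\<^sup>g = g\<^sup>-\<^sup>1 x g\<close>. A permutation \<open>h\<close> acts by
  \<open>h (Lam i j) h\<^sup>-\<^sup>1 = Lam (h i) (h j)\<close>, used here with \<open>h = g\<^sup>-\<^sup>1\<close>. Products of permutations are
  compositions of functions.\<close>

fun conj_gen :: "gen \<Rightarrow> (nat \<Rightarrow> nat) \<Rightarrow> gen" where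
  "conj_gen (Lam i j) g = Lam (inv g i) (inv g j)"

definition conj_rels :: "relator set \<Rightarrow> (nat \<Rightarrow> nat) \<Rightarrow> relator set" where
  "conj_rels R g =
    (\<lambda>(u, v). (map (\<lambda>x. conj_gen x g) u, map (\<lambda>x. conj_gen x g) v)) ` R"

text \<open>The coset representative \<open>\<rho>\<^sub>n \<rho>\<^sub>n\<^sub>-\<^sub>1 \<dots> \<rho>\<^sub>k\<close>; the empty product for \<open>k = n + 1\<close>.\<close>

definition coset_rep :: "nat \<Rightarrow> nat \<Rightarrow> nat \<Rightarrow> nat" where
  "coset_rep n k = foldr (\<circ>) (map rho (rev [k..<Suc n])) id"

lemma conj_gen_rho: "conj_gen (Lam i j) (rho k) = Lam (rho k i) (rho k j)"
  by (simp add: rho_def)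

lemma conj_gen_comp:
  assumes "bij g" "bij h"
  shows "conj_gen x (g \<circ> h) = conj_gen (conj_gen x g) h"
  using assms by (cases x) (simp add: o_inv_distrib)

lemma conj_rels_id: "conj_rels R id = R"
proof -
  have "(\<lambda>x. conj_gen x id) = id"
    by (rule ext) (metis conj_gen.elims conj_gen.simps id_apply inv_id)
  then show ?thesis by (simp add: conj_rels_def)
qed

lemma coset_rep_self: "coset_rep n n = rho n"
  by (simp add: coset_rep_def)

lemma coset_rep_step: "k \<le> n \<Longrightarrow> coset_rep n k = coset_rep n (Suc k) \<circ> rho k"
proof -
  have *: "foldr (\<circ>) fs h = foldr (\<circ>) fs id \<circ> h" for fs :: "(nat \<Rightarrow> nat) list" and h
    by (induction fs) (simp_all add: comp_assoc)
  assume "k \<le> n"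
  then have "[k..<Suc n] = k # [Suc k..<Suc n]" by (simp add: upt_conv_Cons)
  then show ?thesis unfolding coset_rep_def
    by (simp del: upt_Suc) (rule *)
qed

text \<open>The pieces \<open>\<R>\<^sub>n\<^sup>g\<close> cover \<open>\<R>\<^sub>n\<^sub>+\<^sub>1\<close> but overlap for every \<open>n \<ge> 4\<close>: a relation that involves neither
  of two given indices lies in both of the corresponding pieces. The union therefore cannot be
  asserted to be disjoint.\<close>

lemma pieces_overlap:
  assumes "n \<ge> 4"
  shows "VP_rels n \<inter> conj_rels (VP_rels n) (coset_rep n n) \<noteq> {}"
proof -
  let ?r = "([Lam 1 2, Lam 1 3, Lam 2 3], [Lam 2 3, Lam 1 3, Lam 1 2])"
  have "long_rels_at 1 2 3 \<subseteq> long_rels n"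
    unfolding long_rels_def using assms
    by (intro Union_upper CollectI exI[of _ 1] exI[of _ 2] exI[of _ 3] conjI refl) simp_all
  moreover have "?r \<in> long_rels_at 1 2 3" by (simp add: long_rels_at_def)
  ultimately have r: "?r \<in> VP_rels n" by (auto simp: VP_rels_def)
  have inv_rho: "inv (rho n) i = i" if "i < 4" for i
    using that assms by (simp add: rho_def transpose_def)
  have "?r \<in> conj_rels (VP_rels n) (coset_rep n n)"
    unfolding conj_rels_def coset_rep_self
    by (rule image_eqI[OF _ r]) (simp add: inv_rho)
  with r show ?thesis by blast
qed

end

theory Submission
  imports Defs
begin

text \<open>
  The defining relations make sense over any set of indices \<open>A \<subseteq> \<nat>\<close>: they refer to indices only
  through their relative order. Three facts give the theorem.

  First, an order embedding of index sets carries the relations over \<open>A\<close> onto the relations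
  over the image of \<open>A\<close> (\<open>conj_rels_VP_rels_on\<close>).

  Second, conjugation by \<open>\<rho>\<^sub>n \<rho>\<^sub>n\<^sub>-\<^sub>1 \<dots> \<rho>\<^sub>k\<close> acts on the indices as the cycle that sends \<open>n + 1\<close> to \<open>k\<close>
  and raises each of \<open>k, \<dots>, n\<close> by one. On \<open>{1..n}\<close> this is the order embedding that leaves out \<open>k\<close>, so
  the piece belonging to \<open>k\<close> consists exactly of those relations over \<open>{1..n + 1}\<close> in which the index
  \<open>k\<close> does not occur (\<open>conj_rels_coset_rep\<close>). The piece \<open>\<R>\<^sub>n\<close> itself is the case \<open>k = n + 1\<close>.

  Third, a long relation involves three indices and a commutativity relation four. As soon as there are at
  least five indices, every relation therefore misses one of them, and the pieces cover everything
  (\<open>VP_rels_on_cover\<close>). This is where \<open>n \<ge> 4\<close> enters.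
\<close>

definition VP_rels_on :: "nat set \<Rightarrow> relator set" where
  "VP_rels_on A =
    {r. \<exists>i j l. {i, j, l} \<subseteq> A \<and> i < j \<and> j < l \<and> r \<in> long_rels_at i j l} \<union>
    {r. \<exists>i j l m. {i, j, l, m} \<subseteq> A \<and> distinct [i, j, l, m] \<and> i < j \<and> l < m \<and> j > m
        \<and> r \<in> comm_rels_at i j l m}"

lemma VP_rels_on_long:
  "\<lbrakk>{i, j, l} \<subseteq> A; i < j; j < l; r \<in> long_rels_at i j l\<rbrakk> \<Longrightarrow> r \<in> VP_rels_on A"
  unfolding VP_rels_on_def by blast

lemma VP_rels_on_comm:
  "\<lbrakk>{i, j, l, m} \<subseteq> A; distinct [i, j, l, m]; i < j; l < m; j > m; r \<in> comm_rels_at i j l m\<rbrakk>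
    \<Longrightarrow> r \<in> VP_rels_on A"
  unfolding VP_rels_on_def by blast

lemma VP_rels_on_cases:
  assumes "r \<in> VP_rels_on A"
  obtains (long) i j l where "{i, j, l} \<subseteq> A" "i < j" "j < l" "r \<in> long_rels_at i j l"
  | (comm) i j l m where "{i, j, l, m} \<subseteq> A" "distinct [i, j, l, m]" "i < j" "l < m" "j > m"
      "r \<in> comm_rels_at i j l m"
  using assms unfolding VP_rels_on_def Un_iff mem_Collect_eq by metis

lemma long_rels_iff: "r \<in> long_rels k \<longleftrightarrow>
      (\<exists>i j l. {i, j, l} \<subseteq> {1..k} \<and> i < j \<and> j < l \<and> r \<in> long_rels_at i j l)"
proof -
  have "r \<in> long_rels k \<longleftrightarrow>
      (\<exists>i j l. (1 \<le> i \<and> i < j \<and> j < l \<and> l \<le> k) \<and> r \<in> long_rels_at i j l)"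
    unfolding long_rels_def Union_iff Bex_def mem_Collect_eq by metis
  also have "\<dots> \<longleftrightarrow> (\<exists>i j l. {i, j, l} \<subseteq> {1..k} \<and> i < j \<and> j < l \<and> r \<in> long_rels_at i j l)"
    by (intro ex_cong1) auto
  finally show ?thesis .
qed

lemma comm_rels_iff: "r \<in> comm_rels k \<longleftrightarrow>
      (\<exists>i j l m. {i, j, l, m} \<subseteq> {1..k} \<and> distinct [i, j, l, m]
        \<and> i < j \<and> l < m \<and> j > m \<and> r \<in> comm_rels_at i j l m)"
  unfolding comm_rels_def Union_iff Bex_def mem_Collect_eq by metis

lemma VP_rels_eq: "VP_rels k = VP_rels_on {1..k}"
  unfolding VP_rels_def VP_rels_on_def set_eq_iff Un_iff mem_Collect_eq long_rels_iff comm_rels_iff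
  by (intro allI refl)

lemma VP_rels_on_mono:
  assumes "A \<subseteq> B"
  shows "VP_rels_on A \<subseteq> VP_rels_on B"
proof
  fix r assume "r \<in> VP_rels_on A"
  then show "r \<in> VP_rels_on B"
  proof (cases rule: VP_rels_on_cases)
    case (long i j l)
    then show ?thesis
      using assms by (intro VP_rels_on_long[of i j l]) (simp_all add: subset_iff)
  next
    case (comm i j l m)
    then show ?thesis
      using assms by (intro VP_rels_on_comm[of i j l m]) (simp_all add: subset_iff)
  qed
qed


section \<open>Conjugation along order embeddings\<close>

lemma conj_rels_long_rels_at:
  "conj_rels (long_rels_at i j l) g = long_rels_at (inv g i) (inv g j) (inv g l)"
  unfolding conj_rels_def long_rels_at_def
    image_insert image_empty prod.case list.map conj_gen.simps ..

lemma comm_rels_at_eq_image: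
  "comm_rels_at i j l m =
    (\<lambda>(x, y). ([x, y], [y, x])) ` ({Lam i j, Lam j i} \<times> {Lam l m, Lam m l})"
proof -
  have "r \<in> comm_rels_at i j l m \<longleftrightarrow>
      (\<exists>x y. r = ([x, y], [y, x]) \<and> x \<in> {Lam i j, Lam j i} \<and> y \<in> {Lam l m, Lam m l})" for r
    unfolding comm_rels_at_def by (rule mem_Collect_eq)
  then show ?thesis
    unfolding set_eq_iff image_iff Bex_def split_paired_Ex mem_Sigma_iff prod.case by metis
qed

lemma conj_rels_comm_rels_at:
  "conj_rels (comm_rels_at i j l m) g = comm_rels_at (inv g i) (inv g j) (inv g l) (inv g m)"
  unfolding comm_rels_at_eq_image conj_rels_def
  by (simp only: insert_Times_insert image_insert image_empty Sigma_empty1 Sigma_empty2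
      Un_insert_left Un_insert_right Un_empty_left Un_empty_right
      prod.case list.map conj_gen.simps)

text \<open>The map has to preserve the order because of the commutativity relations: the condition \<open>j > m\<close>
  puts the generator with the larger maximal index first. A permutation that does not preserve the
  order can exchange the two generators and so produce \<open>(v, u)\<close> where only \<open>(u, v)\<close> is in the set.\<close>

lemma conj_rels_VP_rels_on:
  assumes mono: "strict_mono_on A (inv g)"
  shows "conj_rels (VP_rels_on A) g = VP_rels_on (inv g ` A)"
proof
  show "conj_rels (VP_rels_on A) g \<subseteq> VP_rels_on (inv g ` A)"
  proof
    fix s assume "s \<in> conj_rels (VP_rels_on A) g"
    then obtain r where r: "r \<in> VP_rels_on A" and s: "s \<in> conj_rels {r} g"
      unfolding conj_rels_def by blast
    from r show "s \<in> VP_rels_on (inv g ` A)"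
    proof (cases rule: VP_rels_on_cases)
      case (long i j l)
      have "s \<in> conj_rels (long_rels_at i j l) g"
        using s long(4) unfolding conj_rels_def by blast
      moreover have "inv g i < inv g j" "inv g j < inv g l"
        using long(1-3) mono by (auto simp: strict_mono_on_def)
      ultimately show ?thesis
        using long(1) by (intro VP_rels_on_long[of "inv g i" "inv g j" "inv g l"])
          (auto simp: conj_rels_long_rels_at)
    next
      case (comm i j l m)
      have "s \<in> conj_rels (comm_rels_at i j l m) g"
        using s comm(6) unfolding conj_rels_def by blast
      moreover have "inv g i < inv g j" "inv g l < inv g m" "inv g m < inv g j"
        using comm(1-5) mono by (auto simp: strict_mono_on_def)
      moreover have "distinct [inv g i, inv g j, inv g l, inv g m]"
        using comm(1,2) strict_mono_on_imp_inj_on[OF mono] by (auto simp: inj_on_def)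
      ultimately show ?thesis
        using comm(1) by (intro VP_rels_on_comm[of "inv g i" "inv g j" "inv g l" "inv g m"])
          (auto simp: conj_rels_comm_rels_at)
    qed
  qed
next
  have less: "inv g a < inv g b \<Longrightarrow> a < b" if "a \<in> A" "b \<in> A" for a b
    using strict_mono_on_less[OF mono that] by blast
  show "VP_rels_on (inv g ` A) \<subseteq> conj_rels (VP_rels_on A) g"
  proof
    fix s assume "s \<in> VP_rels_on (inv g ` A)"
    then show "s \<in> conj_rels (VP_rels_on A) g"
    proof (cases rule: VP_rels_on_cases)
      case (long i' j' l')
      from long(1) obtain i j l where ijl: "i \<in> A" "j \<in> A" "l \<in> A"
        and eq: "i' = inv g i" "j' = inv g j" "l' = inv g l"
        unfolding insert_subset image_iff by blast
      have "long_rels_at i j l \<subseteq> VP_rels_on A"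
        using ijl long(2,3) eq less by (intro subsetI[of "long_rels_at i j l"] VP_rels_on_long[of i j l]) simp_all
      moreover have "s \<in> conj_rels (long_rels_at i j l) g"
        using long(4) eq by (simp add: conj_rels_long_rels_at)
      ultimately show ?thesis
        unfolding conj_rels_def by blast
    next
      case (comm i' j' l' m')
      from comm(1) obtain i j l m where ijlm: "i \<in> A" "j \<in> A" "l \<in> A" "m \<in> A"
        and eq: "i' = inv g i" "j' = inv g j" "l' = inv g l" "m' = inv g m"
        unfolding insert_subset image_iff by blast
      have "distinct [i, j, l, m]"
        using comm(2) eq by auto
      then have "comm_rels_at i j l m \<subseteq> VP_rels_on A"
        using ijlm comm(3-5) eq less by (intro subsetI[of "comm_rels_at i j l m"] VP_rels_on_comm[of i j l m]) simp_all
      moreover have "s \<in> conj_rels (comm_rels_at i j l m) g"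
        using comm(6) eq by (simp add: conj_rels_comm_rels_at)
      ultimately show ?thesis
        unfolding conj_rels_def by blast
    qed
  qed
qed


section \<open>The coset representatives as order embeddings\<close>

lemma coset_rep_Suc: "coset_rep n (Suc n) = id"
  by (simp add: coset_rep_def)

lemma bij_rho: "bij (rho k)"
  by (simp add: rho_def)

lemma inv_rho: "inv (rho k) = rho k"
  by (simp add: rho_def)

text \<open>Descending induction on \<open>k\<close>: the inverse of \<open>\<rho>\<^sub>n \<dots> \<rho>\<^sub>k\<close> first leaves out \<open>k + 1\<close>, and then \<open>\<rho>\<^sub>k\<close>
  moves the only affected value \<open>k\<close> into that gap.\<close>

lemma inv_coset_rep:
  assumes "k \<le> Suc n"
  shows "bij (coset_rep n k) \<and>
    (\<forall>i\<le>n. inv (coset_rep n k) i = (if i < k then i else Suc i))"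
  using assms
proof (induction rule: inc_induct)
  case base
  show ?case
    unfolding coset_rep_Suc inv_id by (intro conjI bij_id) simp
next
  case (step k)
  then have eq: "coset_rep n k = coset_rep n (Suc k) \<circ> rho k"
    by (intro coset_rep_step) simp
  have inv_eq: "inv (coset_rep n k) = rho k \<circ> inv (coset_rep n (Suc k))"
    using step.IH by (simp add: eq o_inv_distrib bij_rho inv_rho)
  have "bij (coset_rep n k)"
    using step.IH by (simp add: eq bij_comp bij_rho)
  then show ?case
    using step.IH by (auto simp: inv_eq rho_def transpose_def)
qed

lemma skip_image:
  assumes "1 \<le> k" "k \<le> Suc n"
  shows "(\<lambda>i. if i < k then i else Suc i) ` {1..n} = {1..Suc n} - {k}"
proof
  show "{1..Suc n} - {k} \<subseteq> (\<lambda>i. if i < k then i else Suc i) ` {1..n}"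
  proof
    fix x assume x: "x \<in> {1..Suc n} - {k}"
    show "x \<in> (\<lambda>i. if i < k then i else Suc i) ` {1..n}"
      by (rule image_eqI[of _ _ "if x < k then x else x - 1"]) (use x assms in auto)
  qed
qed (use assms in auto)

lemma conj_rels_coset_rep:
  assumes "1 \<le> k" "k \<le> Suc n"
  shows "conj_rels (VP_rels n) (coset_rep n k) = VP_rels_on ({1..Suc n} - {k})"
proof -
  have skip: "inv (coset_rep n k) i = (if i < k then i else Suc i)" if "i \<le> n" for i
    using inv_coset_rep[OF assms(2)] that by blast
  have "strict_mono_on {1..n} (inv (coset_rep n k))"
    by (auto simp: strict_mono_on_def skip)
  moreover have "inv (coset_rep n k) ` {1..n} = {1..Suc n} - {k}"
    unfolding skip_image[OF assms, symmetric] by (rule image_cong) (simp_all add: skip)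
  ultimately show ?thesis
    by (simp add: VP_rels_eq conj_rels_VP_rels_on)
qed


section \<open>Covering by relations that miss an index\<close>

lemma VP_rels_on_support:
  assumes "r \<in> VP_rels_on A"
  obtains S where "S \<subseteq> A" "card S \<le> 4" "r \<in> VP_rels_on S"
  using assms
proof (cases rule: VP_rels_on_cases)
  case (long i j l)
  have "card {i, j, l} \<le> 4" by (simp add: card_insert_if)
  then show ?thesis
    using long(1) VP_rels_on_long[OF subset_refl long(2-4)] by (intro that[of "{i, j, l}"])
next
  case (comm i j l m)
  have "card {i, j, l, m} \<le> 4" by (simp add: card_insert_if)
  then show ?thesis
    using comm(1) VP_rels_on_comm[OF subset_refl comm(2-6)] by (intro that[of "{i, j, l, m}"])
qed

lemma VP_rels_on_cover:
  assumes "card A > 4"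
  shows "VP_rels_on A = (\<Union>k\<in>A. VP_rels_on (A - {k}))"
proof
  show "VP_rels_on A \<subseteq> (\<Union>k\<in>A. VP_rels_on (A - {k}))"
  proof
    fix r assume "r \<in> VP_rels_on A"
    then obtain S where S: "S \<subseteq> A" "card S \<le> 4" "r \<in> VP_rels_on S"
      by (rule VP_rels_on_support)
    then have "S \<noteq> A"
      using assms by auto
    then obtain k where "k \<in> A" "k \<notin> S"
      using S(1) by blast
    moreover from this have "S \<subseteq> A - {k}"
      using S by blast
    ultimately show "r \<in> (\<Union>k\<in>A. VP_rels_on (A - {k}))"
      using subsetD[OF VP_rels_on_mono S(3)] by (intro UN_I)
  qed
next
  show "(\<Union>k\<in>A. VP_rels_on (A - {k})) \<subseteq> VP_rels_on A"
    by (intro UN_least VP_rels_on_mono Diff_subset)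
qed

theorem theorem5p3:
  fixes n :: nat
  assumes "n \<ge> 4"
  shows "VP_rels (n + 1) = VP_rels n \<union> (\<Union>k\<in>{1..n}. conj_rels (VP_rels n) (coset_rep n k))"
proof -
  have "VP_rels (n + 1) = (\<Union>k\<in>{1..Suc n}. VP_rels_on ({1..Suc n} - {k}))"
    using assms VP_rels_on_cover[of "{1..Suc n}"] by (simp add: VP_rels_eq)
  also have "\<dots> = (\<Union>k\<in>{1..Suc n}. conj_rels (VP_rels n) (coset_rep n k))"
    by (simp add: conj_rels_coset_rep)
  also have "{1..Suc n} = insert (Suc n) {1..n}"
    by auto
  finally show ?thesis
    by (simp add: coset_rep_Suc conj_rels_id)
qed

end
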